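(* Let $\gamma\in\mathbb R$ with $|\gamma|=1$. Then: (i) the estimate $$\|uv\|_{X^{s,-1/2+}_{per}}\lesssim\|u\|_{Y^{s-1/2,1/2}_{\gamma,per}}\|v\|_{X^{s,1/2}_{per}}$$ fails for any $s\in\mathbb R$; (ii) the estimate $$\|\partial_x(u\bar v)\|_{Y^{s-1/2,-1/2+}_{\gamma,per}}\lesssim\|u\|_{X^{s,1/2}_{per}}\|v\|_{X^{s,1/2}_{per}}$$ fails for any $s\in\mathbb R$.
   Context: Functions $u(t,x)$ are complex-valued on $\mathbb R\times\mathbb T$, with $\mathbb T=\mathbb R/L\mathbb Z$ and $L>0$ a fixed period; $\widehat u(\tau,n)$ ($\tau\in\mathbb R,n\in\mathbb Z$) is the Fourier transform in $t$ and the $n$-th Fourier coefficient in $x$ (with respect to $e^{2\pi inx/L}$). With $\langle x\rangle=1+|x|$, $$\|u\|_{X^{s,b}_{per}}=\Big(\sum_{n\in\mathbb Z}\int_{\mathbb R}\langle\tau+n^2\rangle^{2b}\langle n\rangle^{2s}|\widehat u(\tau,n)|^2d\tau\Big)^{1/2},$$ $$\|u\|_{Y^{s,b}_{\gamma,per}}=\Big(\sum_{n\in\mathbb Z}\int_{\mathbb R}\langle\tau+\gamma|n|n\rangle^{2b}\langle n\rangle^{2s}|\widehat u(\tau,n)|^2d\tau\Big)^{1/2}.$$ The exponent $-1/2+$ denotes $-1/2+\epsilon$ with $\epsilon>0$ small. "The estimate fails" means that (for every small $\epsilon>0$) there is no constant $C$ such that the inequality with $\lesssim$ replaced by $\le C\,\cdot$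 holds for all $u,v$ for which the right-hand side is finite. *)

theory Defs
  imports "HOL-Analysis.Analysis"
begin

text \<open>
  A function on \<open>\<real> \<times> \<real>/L\<int>\<close> is represented by an \<open>L\<close>-periodic (in the second variable) function
  of \<open>(t, x) \<in> \<real> \<times> \<real>\<close>. The spaces contain functions that are not integrable in \<open>(t, x)\<close>, and a
  product need not be differentiable in \<open>x\<close>; therefore the Fourier transform and
  \<open>\<partial>\<^sub>x\<close> are taken in the sense of tempered distributions on \<open>\<real> \<times> \<real>/L\<int>\<close>.
\<close>

type_synonym spacetime_fun = "real \<times> real \<Rightarrow> complex"
type_synonym distrib = "spacetime_fun \<Rightarrow> complex"

definition tempered_fun :: "real \<Rightarrow> spacetime_fun \<Rightarrow> bool" where
  "tempered_fun L u \<longleftrightarrow>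
     (\<forall>t x. u (t, x + L) = u (t, x)) \<and>
     (\<exists>k::nat. set_integrable lborel (UNIV \<times> {0..L}) (\<lambda>(t, x). u (t, x) /\<^sub>R (1 + \<bar>t\<bar>) ^ k))"

definition distrib_of :: "real \<Rightarrow> spacetime_fun \<Rightarrow> distrib" where
  "distrib_of L u = (\<lambda>\<psi>. set_lebesgue_integral lborel (UNIV \<times> {0..L}) (\<lambda>p. u p * \<psi> p))"

definition distrib_dx :: "distrib \<Rightarrow> distrib" where
  "distrib_dx T = (\<lambda>\<psi>. - T (\<lambda>(t, x). vector_derivative (\<lambda>y. \<psi> (t, y)) (at x)))"

definition schwartz :: "(real \<Rightarrow> complex) \<Rightarrow> bool" where
  "schwartz \<phi> \<longleftrightarrow>
     (\<exists>D :: nat \<Rightarrow> real \<Rightarrow> complex. D 0 = \<phi> \<and>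
        (\<forall>k t. (D k has_vector_derivative D (Suc k) t) (at t)) \<and>
        (\<forall>j k. bounded (range (\<lambda>t. t ^ j *\<^sub>R D k t))))"

definition fourier_real :: "(real \<Rightarrow> complex) \<Rightarrow> real \<Rightarrow> complex" where
  "fourier_real \<phi> t = (LINT \<tau>|lborel. cis (- (\<tau> * t)) * \<phi> \<tau>)"

text \<open>
  \<open>g \<tau> n\<close> is the Fourier transform in \<open>t\<close> and \<open>n\<close>-th Fourier coefficient in \<open>x\<close> of \<open>T\<close>, with
  the normalisation
  \<open>g \<tau> n = 1/L \<integral>\<^sub>\<real> \<integral>\<^sub>[\<^sub>0\<^sub>,\<^sub>L\<^sub>] u(t,x) exp(- i \<tau> t) exp(- 2 \<pi> i n x / L) dx dt\<close> when \<open>T\<close> is given by an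
  integrable \<open>u\<close>. For general \<open>T\<close> the transform is moved onto the test function.
\<close>

definition is_fourier_transform :: "real \<Rightarrow> distrib \<Rightarrow> (real \<Rightarrow> int \<Rightarrow> complex) \<Rightarrow> bool" where
  "is_fourier_transform L T g \<longleftrightarrow>
     (\<forall>n. (\<lambda>\<tau>. g \<tau> n) \<in> borel_measurable borel \<and>
        (\<forall>\<phi>. schwartz \<phi> \<longrightarrow>
           integrable lborel (\<lambda>\<tau>. g \<tau> n * \<phi> \<tau>) \<and>
           T (\<lambda>(t, x). fourier_real \<phi> t * cis (- (2 * pi * of_int n * x / L))) / of_real L
             = (LINT \<tau>|lborel. g \<tau> n * \<phi> \<tau>)))"

definition jbracket :: "real \<Rightarrow> real" where
  "jbracket x = 1 + \<bar>x\<bar>"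

definition ennreal_sqrt :: "ennreal \<Rightarrow> ennreal" where
  "ennreal_sqrt a = (if a = \<infinity> then \<infinity> else ennreal (sqrt (enn2real a)))"

definition weighted_norm ::
    "(int \<Rightarrow> real) \<Rightarrow> real \<Rightarrow> real \<Rightarrow> (real \<Rightarrow> int \<Rightarrow> complex) \<Rightarrow> ennreal" where
  "weighted_norm h s b g = ennreal_sqrt
     (\<integral>\<^sup>+n. (\<integral>\<^sup>+\<tau>. ennreal (jbracket (\<tau> + h n) powr (2 * b) *
                              jbracket (of_int n) powr (2 * s) * (cmod (g \<tau> n))\<^sup>2) \<partial>lborel)
        \<partial>count_space (UNIV :: int set))"

text \<open>
  A Fourier transform that is a function is unique up to null sets for each \<open>n\<close>, so the infimum
  runs over at most one value; it is \<open>\<infinity>\<close> when the Fourier transform is not a function.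
\<close>

definition bourgain_norm :: "real \<Rightarrow> (int \<Rightarrow> real) \<Rightarrow> real \<Rightarrow> real \<Rightarrow> distrib \<Rightarrow> ennreal" where
  "bourgain_norm L h s b T = (INF g \<in> {g. is_fourier_transform L T g}. weighted_norm h s b g)"

definition X_norm :: "real \<Rightarrow> real \<Rightarrow> real \<Rightarrow> distrib \<Rightarrow> ennreal" where
  "X_norm L s b = bourgain_norm L (\<lambda>n. (of_int n)\<^sup>2) s b"

definition Y_norm :: "real \<Rightarrow> real \<Rightarrow> real \<Rightarrow> real \<Rightarrow> distrib \<Rightarrow> ennreal" where
  "Y_norm L \<gamma> s b = bourgain_norm L (\<lambda>n. \<gamma> * \<bar>of_int n\<bar> * of_int n) s b"

end

theory Submission
  imports Defs "HOL-Probability.Probability"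
begin

text \<open>
  Let \<open>N\<close> have modulus \<open>m\<close> and the sign of \<open>\<gamma>\<close>, so that \<open>\<gamma> \<bar>N\<bar> N = N\<^sup>2\<close>: on frequency \<open>N\<close> the two
  dispersion relations agree. Take \<open>u\<close> to be the Gaussian wave packet \<open>exp (2\<pi>iNx/L - iN\<^sup>2t - t\<^sup>2/2)\<close> and
  \<open>v = exp (- t\<^sup>2/2)\<close>, up to constants. Then \<open>u\<close>, \<open>v\<close> and \<open>uv\<close> all live at bounded distance from the
  characteristic curves, so the modulation weights are irrelevant and the powers of \<open>1 + m\<close> are
  compared directly: \<open>s\<close> against \<open>s - 1/2\<close> in (i), and, because of the derivative, \<open>s + 1/2\<close>
  against \<open>s\<close> in (ii). In both cases half a power of \<open>m\<close> is lost.
\<close>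

section \<open>Product integrals and positivity of integrals\<close>

text \<open>Fubini for separated variables: waves and test functions both split into a factor in t
  and a factor in x, so every pairing below reduces to two one-dimensional integrals.\<close>

lemma tensor_lborel:
  fixes f g :: "real \<Rightarrow> complex"
  assumes f: "integrable lborel f" and g: "integrable lborel g"
  shows integrable_tensor_lborel: "integrable lborel (\<lambda>p. f (fst p) * g (snd p))"
    and integral_tensor_lborel:
      "(LINT p|lborel. f (fst p) * g (snd p)) = (LINT t|lborel. f t) * (LINT x|lborel. g x)"
proof -
  note [measurable] = borel_measurable_integrable[OF f] borel_measurable_integrable[OF g]
  have int: "integrable (lborel \<Otimes>\<^sub>M lborel) (\<lambda>p. f (fst p) * g (snd p))"
    by (rule lborel_pair.Fubini_integrable) (use f g in \<open>auto simp: norm_mult\<close>)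
  then show "integrable lborel (\<lambda>p. f (fst p) * g (snd p))"
    by (simp add: lborel_prod)
  show "(LINT p|lborel. f (fst p) * g (snd p)) = (LINT t|lborel. f t) * (LINT x|lborel. g x)"
    using lborel_pair.integral_fst'[OF int] by (simp add: lborel_prod)
qed

lemma integral_lborel_pos:
  fixes f :: "real \<Rightarrow> real"
  assumes f: "integrable lborel f" and pos: "\<And>x. f x > 0"
  shows "(LINT x|lborel. f x) > 0"
proof -
  have "(LINT x|lborel. f x) \<noteq> 0"
  proof
    assume "(LINT x|lborel. f x) = 0"
    then have "AE x in lborel. f x = 0"
      using integral_nonneg_eq_0_iff_AE[OF f] pos by (auto simp: less_imp_le)
    then have "AE x in (lborel :: real measure). False"
      by eventually_elim (use pos in \<open>metis less_irrefl\<close>)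
    then show False by (simp add: AE_iff_measurable[where N=UNIV])
  qed
  moreover have "(LINT x|lborel. f x) \<ge> 0" using pos by (simp add: less_imp_le)
  ultimately show ?thesis by linarith
qed

section \<open>Gaussian moments with modulation weights\<close>

lemma integrable_exp_half_square: "integrable lborel (\<lambda>t::real. exp (- t\<^sup>2 / 2))"
proof -
  have "(\<lambda>t::real. exp (- t\<^sup>2 / 2)) = (\<lambda>t. sqrt (2 * pi) * std_normal_density t)"
    by (simp add: std_normal_density_def)
  then show ?thesis by simp
qed

text \<open>The squared modulation part of the norm of a Gaussian lying on the characteristic curve.
  The index \<open>c = 2 * b\<close> occurs in upper bounds, and \<open>c = - 2 * b\<close>, from
  the dual weight, in lower bounds.\<close>

definition gauss_moment :: "real \<Rightarrow> real" where
  "gauss_moment c = (LINT \<tau>|lborel. jbracket \<tau> powr c * exp (- \<tau>\<^sup>2))"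

lemma borel_measurable_jbracket [measurable]: "jbracket \<in> borel_measurable borel"
  unfolding jbracket_def[abs_def] by measurable

lemma jbracket_pos: "jbracket x > 0" by (simp add: jbracket_def)

text \<open>Since ln (1 + |t|) \<le> |t|, the weight is at most exp (|c| |t|), and |c| |t| \<le>
  c^2/2 + t^2/2 costs only half of the Gaussian exponent.\<close>

lemma integrable_gauss_moment: "integrable lborel (\<lambda>\<tau>. jbracket \<tau> powr c * exp (- \<tau>\<^sup>2))"
proof (rule Bochner_Integration.integrable_bound)
  show "integrable lborel (\<lambda>t::real. exp (c\<^sup>2 / 2) * exp (- t\<^sup>2 / 2))"
    using integrable_exp_half_square by simp
  have "jbracket t powr c * exp (- t\<^sup>2) \<le> exp (c\<^sup>2 / 2) * exp (- t\<^sup>2 / 2)" for t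
  proof -
    have "0 \<le> ln (1 + \<bar>t\<bar>)" "ln (1 + \<bar>t\<bar>) \<le> \<bar>t\<bar>"
      by (auto simp: ln_add_one_self_le_self)
    then have "c * ln (1 + \<bar>t\<bar>) \<le> \<bar>c\<bar> * \<bar>t\<bar>"
      by (meson abs_ge_self abs_ge_zero mult_mono)
    moreover have "0 \<le> (\<bar>c\<bar> - \<bar>t\<bar>)\<^sup>2" by simp
    then have "\<bar>c\<bar> * \<bar>t\<bar> \<le> c\<^sup>2 / 2 + t\<^sup>2 / 2"
      unfolding power2_diff power2_abs by linarith
    ultimately have "c * ln (1 + \<bar>t\<bar>) + - t\<^sup>2 \<le> c\<^sup>2 / 2 + - t\<^sup>2 / 2"
      by linarith
    then show ?thesis
      by (simp add: jbracket_def powr_def exp_add[symmetric] mult.commute del: exp_add)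
  qed
  then show "AE t in lborel. norm (jbracket t powr c * exp (- t\<^sup>2))
      \<le> norm (exp (c\<^sup>2 / 2) * exp (- t\<^sup>2 / 2))"
    by auto
qed measurable

lemma gauss_moment_pos: "gauss_moment c > 0"
  unfolding gauss_moment_def
  by (rule integral_lborel_pos[OF integrable_gauss_moment])
     (simp add: jbracket_pos less_imp_neq[OF jbracket_pos, symmetric])

text \<open>Translation invariance of Lebesgue measure. This makes the later constants independent
  of the frequency.\<close>

lemma nn_integral_gauss_moment:
  "(\<integral>\<^sup>+\<tau>. ennreal (jbracket (\<tau> + a) powr c * exp (- (\<tau> + a)\<^sup>2)) \<partial>lborel) = ennreal (gauss_moment c)"
proof -
  have "(\<integral>\<^sup>+\<tau>. ennreal (jbracket (\<tau> + a) powr c * exp (- (\<tau> + a)\<^sup>2)) \<partial>lborel)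
      = (\<integral>\<^sup>+\<tau>. ennreal (jbracket \<tau> powr c * exp (- \<tau>\<^sup>2)) \<partial>lborel)"
    by (subst (2) nn_integral_real_affine[where c=1 and t=a]) (auto simp: add.commute)
  also have "\<dots> = ennreal (gauss_moment c)"
    unfolding gauss_moment_def
    by (rule nn_integral_eq_integral[OF integrable_gauss_moment]) simp
  finally show ?thesis .
qed

section \<open>Gaussian packets and their Fourier transforms\<close>

text \<open>The phase centres the Fourier transform at \<tau> = -a, so that a dispersion value a
  puts the packet on its curve. The normal density is used because its transform is the known
  characteristic function.\<close>

definition gauss_packet :: "real \<Rightarrow> real \<Rightarrow> complex" where
  "gauss_packet a t = cis (- (a * t)) * of_real (std_normal_density t)"

text \<open>This function has two roles: it is the transform of the packet, and it is the test
  function that detects the mode in the lower bounds.\<close>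

definition gauss_profile :: "real \<Rightarrow> real \<Rightarrow> complex" where
  "gauss_profile a \<tau> = of_real (exp (- (\<tau> + a)\<^sup>2 / 2))"

lemma borel_measurable_cis [measurable]: "cis \<in> borel_measurable borel"
  by (intro borel_measurable_continuous_onI continuous_intros)

lemma integral_cis_std_normal_density:
  "(LINT t|lborel. cis (\<tau> * t) * of_real (std_normal_density t)) = of_real (exp (- \<tau>\<^sup>2 / 2))"
proof -
  have "complex_of_real (exp (- \<tau>\<^sup>2 / 2)) = char std_normal_distribution \<tau>"
    by (simp add: char_std_normal_distribution)
  also have "\<dots> = (LINT t|lborel. std_normal_density t *\<^sub>R iexp (\<tau> * t))"
    unfolding char_def by (subst integral_density) auto
  also have "\<dots> = (LINT t|lborel. cis (\<tau> * t) * of_real (std_normal_density t))"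
    by (simp add: cis_conv_exp scaleR_conv_of_real mult.commute)
  finally show ?thesis by simp
qed

lemma integrable_gauss_packet: "integrable lborel (gauss_packet a)"
  by (rule Bochner_Integration.integrable_bound[OF integrable_normal_density[of 1 0]])
     (auto simp: gauss_packet_def[abs_def] norm_mult)

lemma fourier_gauss_packet: "fourier_real (gauss_packet a) = gauss_profile a"
proof
  fix \<tau>
  have "cis (- (t * \<tau>)) * gauss_packet a t
      = cis (- (\<tau> + a) * t) * of_real (std_normal_density t)" for t
    by (simp add: gauss_packet_def cis_mult mult.assoc[symmetric] algebra_simps)
  then show "fourier_real (gauss_packet a) \<tau> = gauss_profile a \<tau>"
    using integral_cis_std_normal_density[of "- (\<tau> + a)"]
    by (simp add: fourier_real_def gauss_profile_def power2_commute[of "- \<tau>" a] add.commute)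
qed

text \<open>Fourier inversion made explicit: the Gaussian is self-dual up to the factor sqrt (2
  \<pi>), and transforming twice reflects the time variable. The resulting packet with -a is the
  conjugate of the one with a, so its phase cancels in pairings.\<close>

lemma fourier_gauss_profile:
  "fourier_real (gauss_profile a) = (\<lambda>t. of_real (2 * pi) * gauss_packet (- a) t)"
proof
  fix t
  have "fourier_real (gauss_profile a) t
      = (LINT \<tau>|lborel. cis (- ((\<tau> - a) * t)) * of_real (exp (- \<tau>\<^sup>2 / 2)))"
    unfolding fourier_real_def
    by (subst lborel_integral_real_affine[where c=1 and t="- a"]) (auto simp: gauss_profile_def)
  also have "(\<lambda>\<tau>. cis (- ((\<tau> - a) * t)) * complex_of_real (exp (- \<tau>\<^sup>2 / 2)))
      = (\<lambda>\<tau>. (of_real (sqrt (2 * pi)) * cis (a * t))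
              * (cis ((- t) * \<tau>) * of_real (std_normal_density \<tau>)))"
  proof
    fix \<tau>
    have "- ((\<tau> - a) * t) = a * t + (- t) * \<tau>" by (simp add: algebra_simps)
    then have "cis (- ((\<tau> - a) * t)) = cis (a * t) * cis ((- t) * \<tau>)"
      by (simp only: cis_mult)
    moreover have "exp (- \<tau>\<^sup>2 / 2) = sqrt (2 * pi) * std_normal_density \<tau>"
      by (simp add: std_normal_density_def)
    ultimately show "cis (- ((\<tau> - a) * t)) * complex_of_real (exp (- \<tau>\<^sup>2 / 2))
      = (of_real (sqrt (2 * pi)) * cis (a * t))
              * (cis ((- t) * \<tau>) * of_real (std_normal_density \<tau>))"
      by (simp only: of_real_mult mult_ac)
  qed
  also have "(LINT \<tau>|lborel. \<dots> \<tau>)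
      = (of_real (sqrt (2 * pi)) * cis (a * t)) * of_real (exp (- t\<^sup>2 / 2))"
    using integral_cis_std_normal_density[of "- t"] by simp
  also have "\<dots> = of_real (2 * pi) * gauss_packet (- a) t"
  proof -
    have "sqrt (2 * pi) * exp (- t\<^sup>2 / 2) = 2 * pi * std_normal_density t"
      by (simp add: std_normal_density_def field_simps flip: real_sqrt_mult)
    then have "complex_of_real (sqrt (2 * pi)) * of_real (exp (- t\<^sup>2 / 2))
        = of_real (2 * pi) * of_real (std_normal_density t)"
      by (simp only: of_real_mult[symmetric])
    then show ?thesis
      unfolding gauss_packet_def by (simp add: mult_ac del: of_real_mult)
  qed
  finally show "fourier_real (gauss_profile a) t = of_real (2 * pi) * gauss_packet (- a) t" .
qed

section \<open>Gaussian profiles as Schwartz functions\<close>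

text \<open>The polynomial factor in the k-th derivative of exp (-(t + a)^2/2): up to the sign
  (-1)^k, the probabilists' Hermite polynomial at t + a.\<close>

fun hermite_shift :: "real \<Rightarrow> nat \<Rightarrow> real poly" where
  "hermite_shift a 0 = 1"
| "hermite_shift a (Suc k) = pderiv (hermite_shift a k) - [:a, 1:] * hermite_shift a k"

text \<open>One term of the exponential series gives |t|^k \<le> k! exp |t|, and completing the
  square bounds |t| - (t + a)^2/2 by |a| + 1/2. Summing over the coefficients handles any
  polynomial.\<close>

lemma bounded_poly_gauss:
  fixes p :: "real poly"
  shows "bounded (range (\<lambda>t. complex_of_real (poly p t * exp (- (t + a)\<^sup>2 / 2))))"
proof -
  have mono: "\<bar>t\<bar> ^ k * exp (- (t + a)\<^sup>2 / 2) \<le> fact k * exp (\<bar>a\<bar> + 1 / 2)" for t k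
  proof -
    have "\<bar>t\<bar> ^ k \<le> fact k * exp \<bar>t\<bar>"
    proof -
      have "(\<Sum>n\<in>{k}. \<bar>t\<bar> ^ n /\<^sub>R fact n) \<le> exp \<bar>t\<bar>"
        unfolding exp_def by (intro sum_le_suminf summable_exp_generic) auto
      then show ?thesis by (simp add: field_simps)
    qed
    moreover have "\<bar>t\<bar> + - (t + a)\<^sup>2 / 2 \<le> \<bar>a\<bar> + 1 / 2"
    proof -
      have "0 \<le> (\<bar>t + a\<bar> - 1)\<^sup>2" by simp
      then have "\<bar>t + a\<bar> \<le> (t + a)\<^sup>2 / 2 + 1 / 2"
        unfolding power2_diff power2_abs by simp
      then show ?thesis by linarith
    qed
    then have "exp \<bar>t\<bar> * exp (- (t + a)\<^sup>2 / 2) \<le> exp (\<bar>a\<bar> + 1 / 2)"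
      by (simp add: exp_add[symmetric] del: exp_add)
    ultimately show ?thesis
      by (smt (verit) exp_gt_zero fact_gt_zero mult.assoc mult_left_mono mult_right_mono)
  qed
  show ?thesis
  proof (rule boundedI)
    fix z assume "z \<in> range (\<lambda>t. complex_of_real (poly p t * exp (- (t + a)\<^sup>2 / 2)))"
    then obtain t where z: "z = complex_of_real (poly p t * exp (- (t + a)\<^sup>2 / 2))" by auto
    have "norm z = \<bar>\<Sum>i\<le>degree p. coeff p i * t ^ i\<bar> * exp (- (t + a)\<^sup>2 / 2)"
      unfolding z norm_of_real abs_mult poly_altdef by simp
    also have "\<dots> \<le> (\<Sum>i\<le>degree p. \<bar>coeff p i * t ^ i\<bar>) * exp (- (t + a)\<^sup>2 / 2)"
      by (intro mult_right_mono sum_abs) simp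
    also have "\<dots> = (\<Sum>i\<le>degree p. \<bar>coeff p i\<bar> * (\<bar>t\<bar> ^ i * exp (- (t + a)\<^sup>2 / 2)))"
      by (simp add: sum_distrib_right abs_mult power_abs mult.assoc)
    also have "\<dots> \<le> (\<Sum>i\<le>degree p. \<bar>coeff p i\<bar> * (fact i * exp (\<bar>a\<bar> + 1 / 2)))"
      by (intro sum_mono mult_left_mono mono) simp
    finally show "norm z \<le> (\<Sum>i\<le>degree p. \<bar>coeff p i\<bar> * (fact i * exp (\<bar>a\<bar> + 1 / 2)))" .
  qed
qed

text \<open>Needed so that the profile is an admissible test function in
  \<open>is_fourier_transform\<close>. A factor t^j is absorbed into the Hermite polynomial, so one
  polynomial bound covers all seminorms.\<close>

lemma schwartz_gauss_profile: "schwartz (gauss_profile a)"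
  unfolding schwartz_def
proof (intro exI[of _ "\<lambda>k t. complex_of_real (poly (hermite_shift a k) t * exp (- (t + a)\<^sup>2 / 2))"]
    conjI allI)
  show "(\<lambda>t. complex_of_real (poly (hermite_shift a 0) t * exp (- (t + a)\<^sup>2 / 2))) = gauss_profile a"
    by (simp add: gauss_profile_def fun_eq_iff)
next
  fix k t
  have "((\<lambda>t. poly (hermite_shift a k) t * exp (- (t + a)\<^sup>2 / 2)) has_real_derivative
      poly (hermite_shift a (Suc k)) t * exp (- (t + a)\<^sup>2 / 2)) (at t)"
    by (auto intro!: derivative_eq_intros poly_DERIV simp: algebra_simps)
  then show "((\<lambda>t. complex_of_real (poly (hermite_shift a k) t * exp (- (t + a)\<^sup>2 / 2)))
      has_vector_derivative
      complex_of_real (poly (hermite_shift a (Suc k)) t * exp (- (t + a)\<^sup>2 / 2))) (at t)"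
    by (intro has_vector_derivative_of_real) (simp add: has_real_derivative_iff_has_vector_derivative)
next
  fix j k
  have "t ^ j *\<^sub>R complex_of_real (poly (hermite_shift a k) t * exp (- (t + a)\<^sup>2 / 2))
      = complex_of_real (poly (monom 1 j * hermite_shift a k) t * exp (- (t + a)\<^sup>2 / 2))" for t
    by (simp add: scaleR_conv_of_real poly_monom)
  then show "bounded (range (\<lambda>t. t ^ j *\<^sub>R
      complex_of_real (poly (hermite_shift a k) t * exp (- (t + a)\<^sup>2 / 2))))"
    using bounded_poly_gauss[of "monom 1 j * hermite_shift a k" a] by simp
qed

lemma integrable_gauss_profile: "integrable lborel (gauss_profile a)"
proof -
  have "integrable lborel (\<lambda>t. complex_of_real (exp (- (a + 1 * t)\<^sup>2 / 2)))"
    by (intro lborel_integrable_real_affine integrable_of_real integrable_exp_half_square) auto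
  then show ?thesis by (simp add: gauss_profile_def[abs_def] add.commute)
qed

section \<open>The Fourier transform of integrable functions\<close>

lemma schwartz_measurable: "schwartz \<phi> \<Longrightarrow> \<phi> \<in> borel_measurable borel"
  unfolding schwartz_def
  by (metis borel_measurable_continuous_onI continuous_at_imp_continuous_on
      has_vector_derivative_continuous)

text \<open>The seminorms with j = 0 and j = 2 together dominate the function by a multiple of 1/(1
  + t^2).\<close>

lemma schwartz_integrable:
  assumes "schwartz \<phi>"
  shows "integrable lborel \<phi>"
proof -
  obtain D where D: "D 0 = \<phi>" "\<And>j k. bounded (range (\<lambda>t::real. t ^ j *\<^sub>R (D k t :: complex)))"
    using assms unfolding schwartz_def by auto
  obtain A B where A: "\<And>t. norm (\<phi> t) \<le> A" and B: "\<And>t. t\<^sup>2 * norm (\<phi> t) \<le> B"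
    using D(2)[of 0 0] D(2)[of 2 0] by (auto simp: bounded_iff D(1))
  show ?thesis
  proof (rule Bochner_Integration.integrable_bound)
    have "integrable lborel (\<lambda>t::real. inverse (1 + t\<^sup>2))"
      using integrable_inverse_1_plus_square by (simp add: set_integrable_def einterval_def)
    then show "integrable lborel (\<lambda>t::real. (A + B) * inverse (1 + t\<^sup>2))"
      by simp
    have "norm (\<phi> t) \<le> (A + B) * inverse (1 + t\<^sup>2)" for t
    proof -
      have "norm (\<phi> t) * (1 + t\<^sup>2) \<le> A + B"
        using A[of t] B[of t] by (simp add: algebra_simps)
      moreover have "1 + t\<^sup>2 > 0" by (simp add: add_pos_nonneg)
      ultimately show ?thesis by (simp add: field_simps)
    qed
    then show "AE t in lborel. norm (\<phi> t) \<le> norm ((A + B) * inverse (1 + t\<^sup>2))"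
      by (intro AE_I2) (metis abs_ge_self order_trans real_norm_def)
  qed (use schwartz_measurable[OF assms] in simp)
qed

lemma borel_measurable_fourier_real:
  assumes "integrable lborel f"
  shows "fourier_real f \<in> borel_measurable borel"
proof -
  note [measurable] = borel_measurable_integrable[OF assms]
  show ?thesis unfolding fourier_real_def[abs_def] by measurable
qed

lemma norm_fourier_real_le:
  assumes "integrable lborel f"
  shows "cmod (fourier_real f t) \<le> (LINT x|lborel. cmod (f x))"
  unfolding fourier_real_def
  by (rule order_trans[OF integral_norm_bound]) (simp add: norm_mult)

lemma integrable_fourier_mult:
  assumes f: "integrable lborel f" and g: "integrable lborel g"
  shows "integrable lborel (\<lambda>t. fourier_real f t * g t)"
proof (rule Bochner_Integration.integrable_bound)
  show "integrable lborel (\<lambda>t. (LINT x|lborel. cmod (f x)) * cmod (g t))"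
    using g by simp
  show "AE t in lborel. norm (fourier_real f t * g t)
      \<le> norm ((LINT x|lborel. cmod (f x)) * cmod (g t))"
    by (auto simp: norm_mult abs_mult
      intro!: mult_right_mono order_trans[OF norm_fourier_real_le[OF f]])
qed (use borel_measurable_fourier_real[OF f] borel_measurable_integrable[OF g] in measurable)

text \<open>Fubini, with |f(t)| |g(\<tau>)| as integrable majorant. This identity links the
  distributional transform, defined by duality, to the classical one.\<close>

lemma fourier_real_multiplication:
  assumes f: "integrable lborel f" and g: "integrable lborel g"
  shows "(LINT t|lborel. f t * fourier_real g t) = (LINT \<tau>|lborel. fourier_real f \<tau> * g \<tau>)"
proof -
  note [measurable] = borel_measurable_integrable[OF f] borel_measurable_integrable[OF g]
  have "integrable (lborel \<Otimes>\<^sub>M lborel) (\<lambda>(t, \<tau>). f t * (cis (- (\<tau> * t)) * g \<tau>))"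
  proof (rule Bochner_Integration.integrable_bound)
    show "integrable (lborel \<Otimes>\<^sub>M lborel) (\<lambda>p. f (fst p) * g (snd p))"
      using integrable_tensor_lborel[OF f g] by (simp add: lborel_prod)
  qed (auto simp: norm_mult)
  from lborel_pair.Fubini_integral[OF this]
  have "(LINT t|lborel. LINT \<tau>|lborel. f t * (cis (- (\<tau> * t)) * g \<tau>))
      = (LINT \<tau>|lborel. LINT t|lborel. f t * (cis (- (\<tau> * t)) * g \<tau>))"
    by simp
  moreover have "(LINT t|lborel. f t * (cis (- (\<tau> * t)) * g \<tau>)) = fourier_real f \<tau> * g \<tau>" for \<tau>
  proof -
    have "(LINT t|lborel. f t * (cis (- (\<tau> * t)) * g \<tau>))
        = (LINT t|lborel. (cis (- (t * \<tau>)) * f t) * g \<tau>)"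
      by (intro Bochner_Integration.integral_cong) (auto simp: mult_ac)
    also have "\<dots> = fourier_real f \<tau> * g \<tau>"
      unfolding fourier_real_def by (rule integral_mult_left_zero)
    finally show ?thesis .
  qed
  moreover have "(LINT \<tau>|lborel. f t * (cis (- (\<tau> * t)) * g \<tau>)) = f t * fourier_real g t" for t
    unfolding fourier_real_def by (rule integral_mult_right_zero)
  ultimately show ?thesis by (simp only:)
qed

section \<open>Single spatial modes and their distributional transforms\<close>

definition wave :: "real \<Rightarrow> int \<Rightarrow> (real \<Rightarrow> complex) \<Rightarrow> spacetime_fun" where
  "wave L n f p = f (fst p) * cis (2 * pi * of_int n * snd p / L)"

lemma wave_mult: "wave L n f p * wave L m g p = wave L (n + m) (\<lambda>t. f t * g t) p"
proof -
  have "2 * pi * of_int (n + m) * snd p / L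
      = 2 * pi * of_int n * snd p / L + 2 * pi * of_int m * snd p / L"
    by (simp add: algebra_simps add_divide_distrib)
  then show ?thesis by (simp only: wave_def cis_mult[symmetric] mult_ac)
qed

lemma cnj_wave: "cnj (wave L n f p) = wave L (- n) (\<lambda>t. cnj (f t)) p"
  by (simp add: wave_def cis_cnj)

lemma has_vector_derivative_cis_mult:
  "((\<lambda>x. cis (c * x)) has_vector_derivative (\<i> * of_real c * cis (c * x))) (at x within S)"
  unfolding has_vector_derivative_def
  by (auto intro!: derivative_eq_intros simp: fun_eq_iff scaleR_conv_of_real)

text \<open>Orthogonality of the characters over one period: for n \<noteq> 0 the antiderivative
  takes the same value at both ends, because c L = 2 \<pi> n.\<close>

lemma
  assumes L: "L > 0"
  shows integrable_cis_period:
      "integrable lborel (\<lambda>x. indicator {0..L} x *\<^sub>R cis (2 * pi * of_int n * x / L))"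
    and integral_cis_period:
      "(LINT x|lborel. indicator {0..L} x *\<^sub>R cis (2 * pi * of_int n * x / L))
        = (if n = 0 then of_real L else 0)"
proof -
  define c where "c = 2 * pi * of_int n / L"
  have c: "2 * pi * of_int n * x / L = c * x" for x by (simp add: c_def)
  show "integrable lborel (\<lambda>x. indicator {0..L} x *\<^sub>R cis (2 * pi * of_int n * x / L))"
    unfolding c by (intro borel_integrable_compact continuous_intros) auto
  show "(LINT x|lborel. indicator {0..L} x *\<^sub>R cis (2 * pi * of_int n * x / L))
        = (if n = 0 then of_real L else 0)"
  proof (cases "n = 0")
    case True
    have "(LINT x|lborel. indicator {0..L} x *\<^sub>R (1::complex)) = of_real L"
      using L by (subst integral_scaleR_left) (auto simp: scaleR_conv_of_real)
    then show ?thesis using True by simp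
  next
    case False
    then have c0: "c \<noteq> 0" using L by (simp add: c_def)
    have "(LINT x|lborel. indicator {0..L} x *\<^sub>R cis (c * x))
        = cis (c * L) / (\<i> * of_real c) - cis (c * 0) / (\<i> * of_real c)"
    proof (rule integral_FTC_Icc)
      fix x
      have "((\<lambda>x. cis (c * x) * (1 / (\<i> * of_real c))) has_vector_derivative
          (\<i> * of_real c * cis (c * x)) * (1 / (\<i> * of_real c))) (at x within {0..L})"
        by (intro has_vector_derivative_mult_left has_vector_derivative_cis_mult)
      then show "((\<lambda>x. cis (c * x) / (\<i> * of_real c)) has_vector_derivative cis (c * x))
          (at x within {0..L})"
        using c0 by (simp add: field_simps)
    qed (use L in \<open>auto intro!: continuous_intros\<close>)
    also have "cis (c * L) = 1"
      using L by (simp add: c_def)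
    finally show ?thesis using False unfolding c by simp
  qed
qed

text \<open>The integrand separates into a time factor and a character of frequency N - n, and
  orthogonality removes every test mode except n = N.\<close>

lemma distrib_of_wave:
  assumes L: "L > 0" and f\<psi>: "integrable lborel (\<lambda>t. f t * \<psi> t)"
  shows "distrib_of L (wave L N f) (\<lambda>(t, x). \<psi> t * cis (- (2 * pi * of_int n * x / L)))
    = (if n = N then of_real L * (LINT t|lborel. f t * \<psi> t) else 0)"
proof -
  have "(indicator (UNIV \<times> {0..L}) p *\<^sub>R
      (wave L N f p * (case p of (t, x) \<Rightarrow> \<psi> t * cis (- (2 * pi * of_int n * x / L)))))
    = (f (fst p) * \<psi> (fst p)) *
      (indicator {0..L} (snd p) *\<^sub>R cis (2 * pi * of_int (N - n) * snd p / L))" for p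
  proof -
    have "2 * pi * of_int (N - n) * snd p / L
        = 2 * pi * of_int N * snd p / L + - (2 * pi * of_int n * snd p / L)"
      by (simp add: algebra_simps diff_divide_distrib)
    then have "cis (2 * pi * of_int (N - n) * snd p / L)
        = cis (2 * pi * of_int N * snd p / L) * cis (- (2 * pi * of_int n * snd p / L))"
      by (simp only: cis_mult)
    moreover have "indicator (UNIV \<times> {0..L}) p = (indicator {0..L} (snd p) :: real)"
      by (simp add: indicator_def mem_Times_iff)
    ultimately show ?thesis
      by (simp add: wave_def split_beta mult_ac del: of_int_diff)
  qed
  then show ?thesis
    unfolding distrib_of_def set_lebesgue_integral_def
    using integral_tensor_lborel[OF f\<psi> integrable_cis_period[OF L, of "N - n"]]
    by (auto simp: integral_cis_period[OF L] simp del: of_int_diff)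
qed

lemma tempered_wave:
  assumes L: "L > 0" and f: "integrable lborel f"
  shows "tempered_fun L (wave L N f)"
  unfolding tempered_fun_def
\<comment> \<open>The profile is integrable in time, so the exponent 0 for the polynomial weight
  suffices.\<close>
proof (intro conjI allI exI[of _ 0])
  fix t x
  have "2 * pi * of_int N * (x + L) / L = 2 * pi * of_int N * x / L + 2 * pi * of_int N"
    using L by (simp add: field_simps)
  then have "cis (2 * pi * of_int N * (x + L) / L) = cis (2 * pi * of_int N * x / L)"
    by (simp only: cis_mult[symmetric]) simp
  then show "wave L N f (t, x + L) = wave L N f (t, x)"
    by (simp add: wave_def)
next
  have "indicator (UNIV \<times> {0..L}) p *\<^sub>R (case p of (t, x) \<Rightarrow> wave L N f (t, x) /\<^sub>R (1 + \<bar>t\<bar>) ^ 0)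
      = f (fst p) * (indicator {0..L} (snd p) *\<^sub>R cis (2 * pi * of_int N * snd p / L))" for p
    by (auto simp: wave_def split_beta indicator_def mem_Times_iff)
  then show "set_integrable lborel (UNIV \<times> {0..L}) (\<lambda>(t, x). wave L N f (t, x) /\<^sub>R (1 + \<bar>t\<bar>) ^ 0)"
    unfolding set_integrable_def
    using integrable_tensor_lborel[OF f integrable_cis_period[OF L]] by simp
qed

text \<open>On the mode N this is the multiplication formula, with the period length cancelling the
  normalisation 1/L; on the other modes both sides vanish by orthogonality.\<close>

lemma is_fourier_transform_wave:
  assumes L: "L > 0" and f: "integrable lborel f"
  shows "is_fourier_transform L (distrib_of L (wave L N f))
    (\<lambda>\<tau> n. if n = N then fourier_real f \<tau> else 0)"
  unfolding is_fourier_transform_def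
proof (intro allI conjI impI)
  fix n
  show "(\<lambda>\<tau>. if n = N then fourier_real f \<tau> else 0) \<in> borel_measurable borel"
    using borel_measurable_fourier_real[OF f] by (cases "n = N") auto
  fix \<phi> assume "schwartz \<phi>"
  then have \<phi>: "integrable lborel \<phi>" by (rule schwartz_integrable)
  show "integrable lborel (\<lambda>\<tau>. (if n = N then fourier_real f \<tau> else 0) * \<phi> \<tau>)"
    using integrable_fourier_mult[OF f \<phi>] by (cases "n = N") auto
  have "integrable lborel (\<lambda>t. f t * fourier_real \<phi> t)"
    using integrable_fourier_mult[OF \<phi> f] by (simp add: mult.commute)
  then show "distrib_of L (wave L N f)
        (\<lambda>(t, x). fourier_real \<phi> t * cis (- (2 * pi * of_int n * x / L))) / of_real L
      = (LINT \<tau>|lborel. (if n = N then fourier_real f \<tau> else 0) * \<phi> \<tau>)"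
    using L by (auto simp: distrib_of_wave fourier_real_multiplication[OF f \<phi>])
qed

section \<open>Upper and lower bounds for the Bourgain norms\<close>

lemma ennreal_sqrt_mono: "a \<le> b \<Longrightarrow> ennreal_sqrt a \<le> ennreal_sqrt b"
  unfolding ennreal_sqrt_def
  by (auto simp: top_unique intro!: ennreal_leI real_sqrt_le_mono enn2real_mono simp flip: top.not_eq_extremum)

lemma ennreal_sqrt_ennreal: "0 \<le> x \<Longrightarrow> ennreal_sqrt (ennreal x) = ennreal (sqrt x)"
  by (simp add: ennreal_sqrt_def)

lemma sqrt_powr_double: "0 < x \<Longrightarrow> sqrt (x powr (2 * s)) = x powr s"
  by (simp add: powr_half_sqrt[symmetric] powr_powr)

lemma powr_square: "(x powr b)\<^sup>2 = (x :: real) powr (2 * b)"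
  by (simp add: power2_eq_square powr_add[symmetric])

text \<open>The profile is centred at \<tau> = -h(N), exactly on the curve. A translation therefore
  removes h(N) from the modulation integral, and only the power of the bracket of N depends on the
  frequency.\<close>

lemma weighted_norm_gauss_profile:
  "weighted_norm h s b (\<lambda>\<tau> n. if n = N then gauss_profile (h N) \<tau> else 0)
    = ennreal (jbracket (of_int N) powr s * sqrt (gauss_moment (2 * b)))"
proof -
  let ?J = "jbracket (of_int N) powr (2 * s)"
  let ?g = "\<lambda>\<tau> n. if n = N then gauss_profile (h N) \<tau> else 0"
  let ?I = "\<lambda>n. \<integral>\<^sup>+\<tau>. ennreal (jbracket (\<tau> + h n) powr (2 * b) *
                              jbracket (of_int n) powr (2 * s) * (cmod (?g \<tau> n))\<^sup>2) \<partial>lborel"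
  have "(\<integral>\<^sup>+n. ?I n \<partial>count_space UNIV) = (\<Sum>n\<in>{N}. ?I n)"
    by (rule nn_integral_count_space') auto
  also have "\<dots> = (\<integral>\<^sup>+\<tau>. ennreal ?J * ennreal (jbracket (\<tau> + h N) powr (2 * b) * exp (- (\<tau> + h N)\<^sup>2)) \<partial>lborel)"
    by (auto simp: gauss_profile_def ennreal_mult[symmetric] mult_ac power2_eq_square[of "exp _"]
        exp_add[symmetric] intro!: nn_integral_cong)
  also have "\<dots> = ennreal ?J * ennreal (gauss_moment (2 * b))"
    by (subst nn_integral_cmult) (auto simp: nn_integral_gauss_moment)
  also have "\<dots> = ennreal (?J * gauss_moment (2 * b))"
    using gauss_moment_pos[of "2 * b"] by (simp add: ennreal_mult)
  finally show ?thesis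
    using gauss_moment_pos[of "2 * b"]
    by (simp add: weighted_norm_def ennreal_sqrt_ennreal real_sqrt_mult sqrt_powr_double jbracket_pos)
qed

text \<open>An infimum is bounded by the value at any one admissible transform, here the explicit
  Gaussian profile.\<close>

lemma bourgain_norm_gauss_packet_le:
  assumes "L > 0"
  shows "bourgain_norm L h s b (distrib_of L (wave L N (gauss_packet (h N))))
    \<le> ennreal (jbracket (of_int N) powr s * sqrt (gauss_moment (2 * b)))"
  unfolding bourgain_norm_def
  using is_fourier_transform_wave[OF assms integrable_gauss_packet, of N "h N",
      unfolded fourier_gauss_packet]
  by (intro INF_lower2) (auto simp: weighted_norm_gauss_profile)

text \<open>Cauchy--Schwarz against the Gaussian bounds the norm of every Fourier transform of \<open>T\<close>
  from below, so uniqueness of the Fourier transform is not needed.\<close>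

lemma bourgain_norm_ge:
  assumes T: "cmod (T (\<lambda>(t, x). fourier_real (gauss_profile (h N)) t *
      cis (- (2 * pi * of_int N * x / L))) / of_real L) = c"
  shows "ennreal (c * jbracket (of_int N) powr s / sqrt (gauss_moment (- 2 * b)))
    \<le> bourgain_norm L h s b T"
  unfolding bourgain_norm_def
proof (rule INF_greatest, clarsimp)
  fix g assume g: "is_fourier_transform L T g"
  let ?\<phi> = "gauss_profile (h N)"
  let ?w = "\<lambda>\<tau>. jbracket (\<tau> + h N)"
  let ?J = "jbracket (of_int N) powr (2 * s)"
  let ?D = "gauss_moment (- 2 * b)"
  have D: "?D > 0" by (rule gauss_moment_pos)
  have c0: "c \<ge> 0" using T by (metis norm_ge_zero)
  have [measurable]: "(\<lambda>\<tau>. g \<tau> N) \<in> borel_measurable borel"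
    using g by (simp add: is_fourier_transform_def)
  have [measurable]: "?\<phi> \<in> borel_measurable borel"
    using borel_measurable_integrable[OF integrable_gauss_profile] by simp
  have int: "integrable lborel (\<lambda>\<tau>. g \<tau> N * ?\<phi> \<tau>)"
    and eq: "c = cmod (LINT \<tau>|lborel. g \<tau> N * ?\<phi> \<tau>)"
    using g schwartz_gauss_profile[of "h N"] T by (auto simp: is_fourier_transform_def)
  define A where "A = (\<integral>\<^sup>+\<tau>. ennreal (?w \<tau> powr (2 * b) * (cmod (g \<tau> N))\<^sup>2) \<partial>lborel)"
  have "ennreal c \<le> (\<integral>\<^sup>+\<tau>. ennreal (cmod (g \<tau> N * ?\<phi> \<tau>)) \<partial>lborel)"
    unfolding eq by (rule integral_norm_bound_ennreal[OF int])
  \<comment> \<open>Insert w^b w^(-b) = 1: the first factor is what the norm of g measures, the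
    second depends only on the test function.\<close>
  also have "\<dots> = (\<integral>\<^sup>+\<tau>. ennreal (?w \<tau> powr b * cmod (g \<tau> N)) *
      ennreal (?w \<tau> powr (- b) * cmod (?\<phi> \<tau>)) \<partial>lborel)"
  proof (rule nn_integral_cong)
    fix \<tau>
    have "?w \<tau> powr b * ?w \<tau> powr (- b) = 1"
      using jbracket_pos[of "\<tau> + h N"] by (simp add: powr_add[symmetric])
    then have "cmod (g \<tau> N * ?\<phi> \<tau>)
        = (?w \<tau> powr b * cmod (g \<tau> N)) * (?w \<tau> powr (- b) * cmod (?\<phi> \<tau>))"
      by (simp add: norm_mult)
    then show "ennreal (cmod (g \<tau> N * ?\<phi> \<tau>))
        = ennreal (?w \<tau> powr b * cmod (g \<tau> N)) * ennreal (?w \<tau> powr (- b) * cmod (?\<phi> \<tau>))"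
      by (simp add: ennreal_mult)
  qed
  finally have "(ennreal c)\<^sup>2 \<le> (\<integral>\<^sup>+\<tau>. ennreal (?w \<tau> powr b * cmod (g \<tau> N)) *
      ennreal (?w \<tau> powr (- b) * cmod (?\<phi> \<tau>)) \<partial>lborel)\<^sup>2"
    by (intro power_mono) auto
  also have "\<dots> \<le> (\<integral>\<^sup>+\<tau>. (ennreal (?w \<tau> powr b * cmod (g \<tau> N)))\<^sup>2 \<partial>lborel) *
      (\<integral>\<^sup>+\<tau>. (ennreal (?w \<tau> powr (- b) * cmod (?\<phi> \<tau>)))\<^sup>2 \<partial>lborel)"
    by (rule Cauchy_Schwarz_nn_integral) measurable
  also have "(\<integral>\<^sup>+\<tau>. (ennreal (?w \<tau> powr b * cmod (g \<tau> N)))\<^sup>2 \<partial>lborel) = A"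
    unfolding A_def
    by (intro nn_integral_cong) (simp add: ennreal_power power_mult_distrib
        powr_square mult.commute)
  also have "(\<integral>\<^sup>+\<tau>. (ennreal (?w \<tau> powr (- b) * cmod (?\<phi> \<tau>)))\<^sup>2 \<partial>lborel) = ennreal ?D"
    unfolding nn_integral_gauss_moment[of "h N", symmetric]
    by (intro nn_integral_cong) (simp add: ennreal_power power_mult_distrib
        powr_square mult.commute gauss_profile_def exp_double[symmetric])
  finally have CS: "(ennreal c)\<^sup>2 \<le> A * ennreal ?D" .
  \<comment> \<open>A now has to be compared with the full norm: the mode N is a single nonnegative
    term of the sum over n.\<close>
  have "ennreal ?J * A = (\<integral>\<^sup>+\<tau>. ennreal (?w \<tau> powr (2 * b) * ?J * (cmod (g \<tau> N))\<^sup>2) \<partial>lborel)"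
    unfolding A_def
    by (subst nn_integral_cmult[symmetric]) (auto simp: ennreal_mult[symmetric] mult_ac)
  also have "\<dots> \<le> (\<integral>\<^sup>+n. (\<integral>\<^sup>+\<tau>. ennreal (jbracket (\<tau> + h n) powr (2 * b) *
      jbracket (of_int n) powr (2 * s) * (cmod (g \<tau> n))\<^sup>2) \<partial>lborel) \<partial>count_space UNIV)"
    by (rule nn_integral_ge_point) simp
  finally have "ennreal_sqrt (ennreal ?J * A) \<le> weighted_norm h s b g"
    unfolding weighted_norm_def by (rule ennreal_sqrt_mono)
  moreover have "ennreal (c * jbracket (of_int N) powr s / sqrt ?D) \<le> ennreal_sqrt (ennreal ?J * A)"
  proof (cases A)
    case (real r)
    have "c\<^sup>2 \<le> r * ?D"
      using CS real c0 D by (simp add: ennreal_power ennreal_mult[symmetric])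
    then have "c\<^sup>2 / ?D \<le> r" using D by (simp add: field_simps)
    then have "?J * (c\<^sup>2 / ?D) \<le> ?J * r" by (intro mult_left_mono) auto
    then have "sqrt (?J * (c\<^sup>2 / ?D)) \<le> sqrt (?J * r)" by (rule real_sqrt_le_mono)
    moreover have "sqrt (?J * (c\<^sup>2 / ?D)) = c * jbracket (of_int N) powr s / sqrt ?D"
      using c0 by (simp add: real_sqrt_mult real_sqrt_divide sqrt_powr_double jbracket_pos)
    ultimately have "c * jbracket (of_int N) powr s / sqrt ?D \<le> sqrt (?J * r)" by (simp only:)
    then show ?thesis
      using real by (simp add: ennreal_mult[symmetric] ennreal_sqrt_ennreal ennreal_leI)
  next
    \<comment> \<open>As 0 times infinity is 0 in \<open>ennreal\<close>, the positivity of the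
      frequency weight is what makes the right-hand side infinite.\<close>
    case top
    have "jbracket (of_int N) \<noteq> 0" using jbracket_pos[of "of_int N"] by simp
    then show ?thesis using top by (simp add: ennreal_mult_top ennreal_sqrt_def)
  qed
  ultimately show "ennreal (c * jbracket (of_int N) powr s / sqrt (gauss_moment (- (2 * b))))
      \<le> weighted_norm h s b g" by simp
qed

section \<open>Pairing the product of two packets with the test mode\<close>

lemma std_normal_density_le_1: "std_normal_density t \<le> 1"
proof -
  have "1 / sqrt (2 * pi) \<le> 1" "exp (- t\<^sup>2 / 2) \<le> 1"
    using pi_ge_two by auto
  then show ?thesis
    unfolding std_normal_density_def by (metis exp_ge_zero mult_le_one)
qed

text \<open>Two of the three densities come from the packets multiplied together; the third, with
  the factor 2 \<pi>, comes from the transform of the test profile.\<close>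

definition gauss_overlap :: real where
  "gauss_overlap = (LINT t|lborel. 2 * pi * std_normal_density t ^ 3)"

lemma integrable_gauss_overlap: "integrable lborel (\<lambda>t. 2 * pi * std_normal_density t ^ 3)"
proof (rule Bochner_Integration.integrable_bound)
  show "integrable lborel (\<lambda>t. 2 * pi * std_normal_density t)" by simp
  have "std_normal_density t ^ 3 \<le> std_normal_density t" for t
    using power_decreasing[of 1 3 "std_normal_density t"] std_normal_density_le_1[of t] by simp
  then show "AE t in lborel. norm (2 * pi * std_normal_density t ^ 3)
      \<le> norm (2 * pi * std_normal_density t)"
    by simp
qed measurable

lemma gauss_overlap_pos: "gauss_overlap > 0"
  unfolding gauss_overlap_def
  by (rule integral_lborel_pos[OF integrable_gauss_overlap]) (simp add: normal_density_pos)

text \<open>The phase of the high packet is cancelled by the opposite phase in the transformed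
  profile. Hence the pairing is positive and independent of a, giving a lower bound uniform in the
  frequency.\<close>

lemma gauss_packet_triple:
  "gauss_packet a t * gauss_packet 0 t * fourier_real (gauss_profile a) t
    = of_real (2 * pi * std_normal_density t ^ 3)"
proof -
  have "cis (- (a * t)) * cis (a * t) = 1" by (simp add: cis_mult)
  then show ?thesis
    by (simp add: fourier_gauss_profile gauss_packet_def power3_eq_cube mult_ac)
qed

lemma integrable_gauss_packet_mult: "integrable lborel (\<lambda>t. gauss_packet a t * gauss_packet 0 t)"
proof (rule Bochner_Integration.integrable_bound[OF integrable_normal_density[of 1 0]])
  have "std_normal_density t * std_normal_density t \<le> std_normal_density t" for t
    using std_normal_density_le_1[of t] by (simp add: mult_left_le)
  then show "AE t in lborel. norm (gauss_packet a t * gauss_packet 0 t) \<le> norm (std_normal_density t)"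
    by (simp add: gauss_packet_def norm_mult)
qed (use borel_measurable_integrable[OF integrable_gauss_packet] in simp_all)

lemma distrib_of_packet_product:
  assumes "L > 0"
  shows "distrib_of L (wave L N (\<lambda>t. gauss_packet a t * gauss_packet 0 t))
      (\<lambda>(t, x). fourier_real (gauss_profile a) t * cis (- (2 * pi * of_int N * x / L)))
    = of_real (L * gauss_overlap)"
proof -
  have "integrable lborel (\<lambda>t. gauss_packet a t * gauss_packet 0 t * fourier_real (gauss_profile a) t)"
    unfolding gauss_packet_triple by (rule integrable_of_real[OF integrable_gauss_overlap])
  moreover have "(LINT t|lborel. complex_of_real (2 * pi * std_normal_density t ^ 3)) = of_real gauss_overlap"
    unfolding gauss_overlap_def by (rule integral_of_real[OF integrable_gauss_overlap])
  ultimately show ?thesis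
    by (simp only: distrib_of_wave[OF assms] gauss_packet_triple of_real_mult simp_thms if_True)
qed

text \<open>The derivative falls on the test mode and multiplies it by -2 \<pi> i N / L; the minus
  sign in \<open>distrib_dx\<close> turns this into the usual Fourier multiplier.\<close>

lemma distrib_dx_of_mode:
  "distrib_dx (distrib_of L u) (\<lambda>(t, x). \<psi> t * cis (- (2 * pi * of_int N * x / L)))
    = \<i> * of_real (2 * pi * of_int N / L) *
      distrib_of L u (\<lambda>(t, x). \<psi> t * cis (- (2 * pi * of_int N * x / L)))"
proof -
  define c where "c = - (2 * pi * of_int N / L)"
  have c: "- (2 * pi * of_int N * x / L) = c * x" for x by (simp add: c_def)
  have "vector_derivative (\<lambda>y. \<psi> t * cis (c * y)) (at x) = \<i> * of_real c * (\<psi> t * cis (c * x))" for t x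
    using vector_derivative_at[OF has_vector_derivative_mult_right[OF
        has_vector_derivative_cis_mult[of c x UNIV], of "\<psi> t"]]
    by (simp add: mult_ac)
  then have "(\<lambda>p. indicator (UNIV \<times> {0..L}) p *\<^sub>R
        (u p * (case p of (t, x) \<Rightarrow> vector_derivative (\<lambda>y. \<psi> t * cis (c * y)) (at x))))
      = (\<lambda>p. (\<i> * of_real c) * (indicator (UNIV \<times> {0..L}) p *\<^sub>R
        (u p * (case p of (t, x) \<Rightarrow> \<psi> t * cis (c * x)))))"
    by (auto simp: fun_eq_iff)
  then have "distrib_of L u (\<lambda>(t, x). vector_derivative (\<lambda>y. \<psi> t * cis (c * y)) (at x))
      = \<i> * of_real c * distrib_of L u (\<lambda>(t, x). \<psi> t * cis (c * x))"
    unfolding distrib_of_def set_lebesgue_integral_def by (simp only: integral_mult_right_zero)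
  then show ?thesis
    unfolding c distrib_dx_def by (simp add: c_def)
qed

section \<open>Growth comparison and passage to real inequalities\<close>

lemma unbounded_sqrt_growth:
  fixes \<alpha> B :: real
  assumes \<alpha>: "\<alpha> > 0"
  shows "\<exists>m::nat. \<alpha> * real m > B * sqrt (1 + real m)"
proof -
  \<comment> \<open>The summand 1 ensures m \<ge> 1 and hence 1 + m \<le> 2 m; the factor 2 then
    gives (B/\<alpha>)^2 (1 + m) \<le> 2 (B/\<alpha>)^2 m < m^2.\<close>
  obtain m :: nat where m: "real m > 2 * (B / \<alpha>)\<^sup>2 + 1"
    using reals_Archimedean2 by blast
  then have m1: "real m \<ge> 1" using zero_le_power2[of "B / \<alpha>"] by linarith
  have "(B / \<alpha>)\<^sup>2 * (1 + real m) \<le> (B / \<alpha>)\<^sup>2 * (2 * real m)"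
    using m1 by (intro mult_left_mono) auto
  also have "\<dots> < real m * real m"
    using m m1 mult_strict_right_mono[of "2 * (B / \<alpha>)\<^sup>2" "real m" "real m"] by (simp add: mult_ac)
  finally have "(B / \<alpha> * sqrt (1 + real m))\<^sup>2 < (real m)\<^sup>2"
    by (simp add: power_mult_distrib power_divide power2_eq_square[of "real m"])
  then have "B / \<alpha> * sqrt (1 + real m) < real m"
    by (rule power2_less_imp_less) simp
  then show ?thesis using \<alpha> by (auto simp: field_simps)
qed

text \<open>After division by (1 + m)^s this compares m with sqrt (1 + m). Both parts of the theorem
  reduce to it.\<close>

lemma unbounded_power_growth:
  fixes \<alpha> B r s :: real
  assumes "\<alpha> > 0" "r = s + 1 / 2"
  shows "\<exists>m::nat. \<alpha> * real m * (1 + real m) powr s > B * (1 + real m) powr r"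
proof -
  obtain m :: nat where "\<alpha> * real m > B * sqrt (1 + real m)"
    using unbounded_sqrt_growth[OF assms(1)] by blast
  moreover have "(1 + real m) powr r = sqrt (1 + real m) * (1 + real m) powr s"
    using assms(2) by (simp add: powr_add powr_half_sqrt)
  ultimately have "B * (1 + real m) powr r < \<alpha> * real m * (1 + real m) powr s"
    using mult_strict_right_mono[of "B * sqrt (1 + real m)" "\<alpha> * real m" "(1 + real m) powr s"]
    by (simp add: mult_ac)
  then show ?thesis by blast
qed

text \<open>The absolute value accounts for a negative C, which \<open>ennreal\<close> sends to
  0.\<close>

lemma bilinear_bound_real:
  assumes "x \<le> ennreal C * y * z" "ennreal a \<le> x" "y \<le> ennreal b" "z \<le> ennreal c" "b \<ge> 0" "c \<ge> 0"
  shows "a \<le> \<bar>C\<bar> * b * c"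
proof -
  have "ennreal a \<le> ennreal \<bar>C\<bar> * ennreal b * ennreal c"
    using assms(1-4) by (intro order_trans[OF assms(2)] order_trans[OF assms(1)] mult_mono ennreal_leI) auto
  also have "\<dots> = ennreal (\<bar>C\<bar> * b * c)"
    using assms(5,6) by (simp add: ennreal_mult)
  finally show ?thesis
    using assms(5,6) by (subst (asm) ennreal_le_iff) auto
qed

section \<open>The resonant counterexample\<close>

context
  fixes L \<gamma> :: real
  assumes L: "L > 0" and \<gamma>: "\<bar>\<gamma>\<bar> = 1"
begin

definition resonant_freq :: "nat \<Rightarrow> int" where
  "resonant_freq m = (if \<gamma> = 1 then int m else - int m)"

text \<open>With N = \<gamma> m one has \<gamma> |N| N = \<gamma>^2 m^2 = m^2, so one packet lies on
  both characteristic curves.\<close>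

lemma resonance: "\<gamma> * \<bar>of_int (resonant_freq m)\<bar> * of_int (resonant_freq m) = (real m)\<^sup>2"
  using \<gamma> by (auto simp: resonant_freq_def power2_eq_square abs_if split: if_splits)

lemma resonant_freq_square: "(of_int (resonant_freq m))\<^sup>2 = (real m)\<^sup>2"
  by (simp add: resonant_freq_def)

lemma abs_resonant_freq: "\<bar>of_int (resonant_freq m)\<bar> = real m"
  by (simp add: resonant_freq_def)

lemma jbracket_resonant_freq: "jbracket (of_int (resonant_freq m)) = 1 + real m"
  by (simp add: jbracket_def abs_resonant_freq)

abbreviation high_wave :: "nat \<Rightarrow> spacetime_fun" where
  "high_wave m \<equiv> wave L (resonant_freq m) (gauss_packet ((real m)\<^sup>2))"

abbreviation low_wave :: spacetime_fun where
  "low_wave \<equiv> wave L 0 (gauss_packet 0)"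

abbreviation product_wave :: "nat \<Rightarrow> spacetime_fun" where
  "product_wave m \<equiv> wave L (resonant_freq m) (\<lambda>t. gauss_packet ((real m)\<^sup>2) t * gauss_packet 0 t)"

lemma high_mult_low: "(\<lambda>p. high_wave m p * low_wave p) = product_wave m"
  by (simp add: fun_eq_iff wave_mult)

text \<open>The low wave has frequency 0 and a real profile, so conjugation fixes it and the same
  product serves both estimates.\<close>

lemma high_mult_cnj_low: "(\<lambda>p. high_wave m p * cnj (low_wave p)) = product_wave m"
proof -
  have "cnj (gauss_packet 0 t) = gauss_packet 0 t" for t
    by (simp add: gauss_packet_def)
  then show ?thesis by (simp add: fun_eq_iff cnj_wave wave_mult)
qed

lemmas tempered_waves =
  tempered_wave[OF L integrable_gauss_packet] tempered_wave[OF L integrable_gauss_packet_mult]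

text \<open>The moment index 1 is 2 b for b = 1/2.\<close>

lemma Y_norm_high_wave_le:
  "Y_norm L \<gamma> s (1/2) (distrib_of L (high_wave m))
    \<le> ennreal ((1 + real m) powr s * sqrt (gauss_moment 1))"
  using bourgain_norm_gauss_packet_le[OF L, of "\<lambda>n. \<gamma> * \<bar>of_int n\<bar> * of_int n" s "1/2" "resonant_freq m"]
  by (simp add: Y_norm_def resonance jbracket_resonant_freq)

lemma X_norm_high_wave_le:
  "X_norm L s (1/2) (distrib_of L (high_wave m))
    \<le> ennreal ((1 + real m) powr s * sqrt (gauss_moment 1))"
  using bourgain_norm_gauss_packet_le[OF L, of "\<lambda>n. (of_int n)\<^sup>2" s "1/2" "resonant_freq m"]
  by (simp add: X_norm_def resonant_freq_square jbracket_resonant_freq)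

lemma X_norm_low_wave_le:
  "X_norm L s (1/2) (distrib_of L low_wave) \<le> ennreal (sqrt (gauss_moment 1))"
  using bourgain_norm_gauss_packet_le[OF L, of "\<lambda>n. (of_int n)\<^sup>2" s "1/2" 0]
  by (simp add: X_norm_def jbracket_def)

text \<open>Obtained by testing against the profile on the resonant mode; b enters only through a
  factor independent of m.\<close>

lemma X_norm_product_wave_ge:
  "ennreal (gauss_overlap * (1 + real m) powr s / sqrt (gauss_moment (- 2 * b)))
    \<le> X_norm L s b (distrib_of L (product_wave m))"
proof -
  have "cmod (distrib_of L (product_wave m)
      (\<lambda>(t, x). fourier_real (gauss_profile ((real m)\<^sup>2)) t *
        cis (- (2 * pi * of_int (resonant_freq m) * x / L))) / of_real L) = gauss_overlap"
    using L gauss_overlap_pos by (simp add: distrib_of_packet_product)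
  then show ?thesis
    using bourgain_norm_ge[where h="\<lambda>n. (of_int n)\<^sup>2" and N="resonant_freq m" and b=b and s=s
        and L=L and T="distrib_of L (product_wave m)"]
    by (simp add: X_norm_def resonant_freq_square jbracket_resonant_freq)
qed

text \<open>The same test as for the X norm, now on the other curve; the derivative contributes the
  factor 2 \<pi> m / L that drives the failure of (ii).\<close>

lemma Y_norm_dx_product_wave_ge:
  "ennreal (2 * pi * real m / L * gauss_overlap * (1 + real m) powr s / sqrt (gauss_moment (- 2 * b)))
    \<le> Y_norm L \<gamma> s b (distrib_dx (distrib_of L (product_wave m)))"
proof -
  have "cmod (distrib_dx (distrib_of L (product_wave m))
      (\<lambda>(t, x). fourier_real (gauss_profile ((real m)\<^sup>2)) t *
        cis (- (2 * pi * of_int (resonant_freq m) * x / L))) / of_real L)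
      = 2 * pi * real m / L * gauss_overlap"
    unfolding distrib_dx_of_mode distrib_of_packet_product[OF L]
    using L gauss_overlap_pos by (simp add: norm_mult norm_divide abs_resonant_freq)
  then show ?thesis
    using bourgain_norm_ge[where h="\<lambda>n. \<gamma> * \<bar>of_int n\<bar> * of_int n" and N="resonant_freq m" and b=b
        and s=s and L=L and T="distrib_dx (distrib_of L (product_wave m))"]
    by (simp add: Y_norm_def resonance jbracket_resonant_freq)
qed

lemma X_estimate_fails:
  "\<not> (\<exists>C::real. \<forall>u v :: spacetime_fun.
        tempered_fun L u \<and> tempered_fun L v \<and> tempered_fun L (\<lambda>p. u p * v p) \<and>
        Y_norm L \<gamma> (s - 1/2) (1/2) (distrib_of L u) < \<infinity> \<and>
        X_norm L s (1/2) (distrib_of L v) < \<infinity> \<longrightarrow>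
        X_norm L s b (distrib_of L (\<lambda>p. u p * v p))
          \<le> ennreal C * Y_norm L \<gamma> (s - 1/2) (1/2) (distrib_of L u)
                      * X_norm L s (1/2) (distrib_of L v))"
proof
  define K M where K_def: "K = sqrt (gauss_moment 1)" and M_def: "M = sqrt (gauss_moment (- 2 * b))"
  assume "\<exists>C::real. \<forall>u v :: spacetime_fun.
        tempered_fun L u \<and> tempered_fun L v \<and> tempered_fun L (\<lambda>p. u p * v p) \<and>
        Y_norm L \<gamma> (s - 1/2) (1/2) (distrib_of L u) < \<infinity> \<and>
        X_norm L s (1/2) (distrib_of L v) < \<infinity> \<longrightarrow>
        X_norm L s b (distrib_of L (\<lambda>p. u p * v p))
          \<le> ennreal C * Y_norm L \<gamma> (s - 1/2) (1/2) (distrib_of L u)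
                      * X_norm L s (1/2) (distrib_of L v)"
  then obtain C where C: "X_norm L s b (distrib_of L (\<lambda>p. u p * v p))
          \<le> ennreal C * Y_norm L \<gamma> (s - 1/2) (1/2) (distrib_of L u)
                      * X_norm L s (1/2) (distrib_of L v)"
    if "tempered_fun L u" "tempered_fun L v" "tempered_fun L (\<lambda>p. u p * v p)"
      "Y_norm L \<gamma> (s - 1/2) (1/2) (distrib_of L u) < \<infinity>"
      "X_norm L s (1/2) (distrib_of L v) < \<infinity>" for u v
    by blast
  have M: "M > 0" and K: "K \<ge> 0"
    unfolding K_def M_def using gauss_moment_pos[of "- 2 * b"] gauss_moment_pos[of 1] by simp_all
  \<comment> \<open>The estimate for the pair of high and low wave: the low wave costs only a
    constant, so exponent s stands against s - 1/2.\<close>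
  have bound: "gauss_overlap / M * (1 + real m) powr s \<le> \<bar>C\<bar> * K * K * (1 + real m) powr (s - 1/2)"
    for m
  proof -
    have "X_norm L s b (distrib_of L (product_wave m))
        \<le> ennreal C * Y_norm L \<gamma> (s - 1/2) (1/2) (distrib_of L (high_wave m))
                    * X_norm L s (1/2) (distrib_of L low_wave)"
      using C[of "high_wave m" low_wave] tempered_waves
        order.strict_trans1[OF Y_norm_high_wave_le ennreal_less_top]
        order.strict_trans1[OF X_norm_low_wave_le ennreal_less_top]
      by (simp add: high_mult_low)
    from bilinear_bound_real[OF this X_norm_product_wave_ge Y_norm_high_wave_le X_norm_low_wave_le,
        folded K_def M_def]
    show ?thesis using K by (simp add: mult_ac)
  qed
  \<comment> \<open>The growth lemma compares m (1 + m)^s with (1 + m)^(s + 1/2), so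
    \<open>bound\<close> is multiplied by 1 + m below, which raises s - 1/2 to s + 1/2.\<close>
  obtain m :: nat where
    "\<bar>C\<bar> * K * K * (1 + real m) powr (s + 1/2) < gauss_overlap / M * real m * (1 + real m) powr s"
    using unbounded_power_growth[of "gauss_overlap / M" "s + 1/2" s "\<bar>C\<bar> * K * K"]
      gauss_overlap_pos M by auto
  also have "\<dots> \<le> (gauss_overlap / M * (1 + real m) powr s) * (1 + real m)"
    using gauss_overlap_pos M by (simp add: field_simps)
  also have "\<dots> \<le> (\<bar>C\<bar> * K * K * (1 + real m) powr (s - 1/2)) * (1 + real m)"
    by (rule mult_right_mono[OF bound]) simp
  also have "\<dots> = \<bar>C\<bar> * K * K * ((1 + real m) powr (s - 1/2) * (1 + real m) powr 1)"
    by simp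
  also have "\<dots> = \<bar>C\<bar> * K * K * (1 + real m) powr (s + 1/2)"
    by (simp only: powr_add[symmetric]) (simp add: add.commute)
  finally show False by simp
qed

lemma Y_estimate_fails:
  "\<not> (\<exists>C::real. \<forall>u v :: spacetime_fun.
        tempered_fun L u \<and> tempered_fun L v \<and> tempered_fun L (\<lambda>p. u p * cnj (v p)) \<and>
        X_norm L s (1/2) (distrib_of L u) < \<infinity> \<and>
        X_norm L s (1/2) (distrib_of L v) < \<infinity> \<longrightarrow>
        Y_norm L \<gamma> (s - 1/2) b (distrib_dx (distrib_of L (\<lambda>p. u p * cnj (v p))))
          \<le> ennreal C * X_norm L s (1/2) (distrib_of L u)
                      * X_norm L s (1/2) (distrib_of L v))"
proof
  define K M where K_def: "K = sqrt (gauss_moment 1)" and M_def: "M = sqrt (gauss_moment (- 2 * b))"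
  assume "\<exists>C::real. \<forall>u v :: spacetime_fun.
        tempered_fun L u \<and> tempered_fun L v \<and> tempered_fun L (\<lambda>p. u p * cnj (v p)) \<and>
        X_norm L s (1/2) (distrib_of L u) < \<infinity> \<and>
        X_norm L s (1/2) (distrib_of L v) < \<infinity> \<longrightarrow>
        Y_norm L \<gamma> (s - 1/2) b (distrib_dx (distrib_of L (\<lambda>p. u p * cnj (v p))))
          \<le> ennreal C * X_norm L s (1/2) (distrib_of L u)
                      * X_norm L s (1/2) (distrib_of L v)"
  then obtain C where C: "Y_norm L \<gamma> (s - 1/2) b (distrib_dx (distrib_of L (\<lambda>p. u p * cnj (v p))))
          \<le> ennreal C * X_norm L s (1/2) (distrib_of L u)
                      * X_norm L s (1/2) (distrib_of L v)"
    if "tempered_fun L u" "tempered_fun L v" "tempered_fun L (\<lambda>p. u p * cnj (v p))"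
      "X_norm L s (1/2) (distrib_of L u) < \<infinity>"
      "X_norm L s (1/2) (distrib_of L v) < \<infinity>" for u v
    by blast
  have M: "M > 0" and K: "K \<ge> 0"
    unfolding K_def M_def using gauss_moment_pos[of "- 2 * b"] gauss_moment_pos[of 1] by simp_all
  \<comment> \<open>Here the derivative already supplies the factor m, so the inequality has the
    shape of the growth lemma, with s - 1/2 as its lower exponent and s as its upper one.\<close>
  have bound: "2 * pi / L * gauss_overlap / M * real m * (1 + real m) powr (s - 1/2)
      \<le> \<bar>C\<bar> * K * K * (1 + real m) powr s" for m
  proof -
    have "Y_norm L \<gamma> (s - 1/2) b (distrib_dx (distrib_of L (product_wave m)))
        \<le> ennreal C * X_norm L s (1/2) (distrib_of L (high_wave m))
                    * X_norm L s (1/2) (distrib_of L low_wave)"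
      using C[of "high_wave m" low_wave] tempered_waves
        order.strict_trans1[OF X_norm_high_wave_le ennreal_less_top]
        order.strict_trans1[OF X_norm_low_wave_le ennreal_less_top]
      by (simp add: high_mult_cnj_low)
    from bilinear_bound_real[OF this Y_norm_dx_product_wave_ge X_norm_high_wave_le X_norm_low_wave_le,
        folded K_def M_def]
    show ?thesis using K by (simp add: mult_ac)
  qed
  obtain m :: nat where
    "\<bar>C\<bar> * K * K * (1 + real m) powr s
      < 2 * pi / L * gauss_overlap / M * real m * (1 + real m) powr (s - 1/2)"
    using unbounded_power_growth[of "2 * pi / L * gauss_overlap / M" s "s - 1/2" "\<bar>C\<bar> * K * K"]
      gauss_overlap_pos M L by auto
  with bound[of m] show False by simp
qed

end

theorem proposition3p5:
  fixes L \<gamma> :: real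
  assumes "L > 0" and "\<bar>\<gamma>\<bar> = 1"
  shows
    "(\<forall>(s::real) (\<epsilon>::real). \<epsilon> > 0 \<longrightarrow>
        \<not> (\<exists>C::real. \<forall>u v :: spacetime_fun.
              tempered_fun L u \<and> tempered_fun L v \<and> tempered_fun L (\<lambda>p. u p * v p) \<and>
              Y_norm L \<gamma> (s - 1/2) (1/2) (distrib_of L u) < \<infinity> \<and>
              X_norm L s (1/2) (distrib_of L v) < \<infinity> \<longrightarrow>
              X_norm L s (-1/2 + \<epsilon>) (distrib_of L (\<lambda>p. u p * v p))
                \<le> ennreal C * Y_norm L \<gamma> (s - 1/2) (1/2) (distrib_of L u)
                            * X_norm L s (1/2) (distrib_of L v)))
     \<and>
     (\<forall>(s::real) (\<epsilon>::real). \<epsilon> > 0 \<longrightarrow>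
        \<not> (\<exists>C::real. \<forall>u v :: spacetime_fun.
              tempered_fun L u \<and> tempered_fun L v \<and> tempered_fun L (\<lambda>p. u p * cnj (v p)) \<and>
              X_norm L s (1/2) (distrib_of L u) < \<infinity> \<and>
              X_norm L s (1/2) (distrib_of L v) < \<infinity> \<longrightarrow>
              Y_norm L \<gamma> (s - 1/2) (-1/2 + \<epsilon>) (distrib_dx (distrib_of L (\<lambda>p. u p * cnj (v p))))
                \<le> ennreal C * X_norm L s (1/2) (distrib_of L u)
                            * X_norm L s (1/2) (distrib_of L v)))"
  by (intro conjI allI impI X_estimate_fails[OF assms] Y_estimate_fails[OF assms])

end
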